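(* Let $k\ge 2$, let $G$ be a connected $k$-uniform hypergraph with $|E(G)|\ge 2$, and let $e=\{w_1,\dots,w_k\}$ be an edge of $G$ with $d_G(w_i)=1$ for $1\le i\le k-1$ and $d_G(w_k)\ge 2$. For $1\le i\le k-1$, let $H_i$ be a connected $k$-uniform hypergraph (possibly a single vertex without edges) with a vertex $v_i\in V(H_i)$, where $G,H_1,\dots,H_{k-1}$ are pairwise vertex-disjoint. Suppose that $|E(H_j)|\ge 1$ for some $j$ with $1\le j\le k-1$. Then $$\rho(G_{e,0}(H_1,\dots,H_{k-1}))>\rho(G_{e,s}(H_1,\dots,H_{k-1}))\quad\text{for every } s \text{ with } j\le s\le k-1.$$
   Context: All hypergraphs are finite. A hypergraph $G$ consists of a nonempty vertex set $V(G)$ and an edge set $E(G)$ whose elements are nonempty subsets of $V(G)$. It is $k$-uniform ($k\ge 2$) if every edge has exactly $k$ vertices. The degree $d_G(v)$ is the number of edges containing $v$. A walk of length $p$ from $u$ to $v$ is a sequence $(v_0,e_1,v_1,\dots,v_{p-1},e_p,v_p)$ with $v_0=u$, $v_p=v$, each $e_i$ an edge containing $v_{i-1}$ and $v_i$, and $v_{i-1}\ne v_i$. A path is a walk with all $v_i$ distinct and all $e_i$ distinct; a single vertex is a path of length $0$. $G$ is connected if there is a path between any two vertices. For connected $G$, the distance $d_G(u,v)$ is the length of a shortest path from $u$ to $v$ (with $d_G(u,u)=0$), the distance matrix is $D(G)=(d_G(u,v))_{u,v\in V(G)}$, and the distance spectral radius $\rho(G)$ is the largest eigenvalue of $D(G)$.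 For $0\le s\le k-1$, $G_{e,s}(H_1,\dots,H_{k-1})$ denotes the hypergraph obtained from $G,H_1,\dots,H_{k-1}$ by identifying $w_i$ of $G$ with $v_i$ of $H_i$ for each $i$ with $s+1\le i\le k-1$, and identifying $w_k$ of $G$ with $v_i$ of $H_i$ for all $i$ with $1\le i\le s$. *)

theory Defs
  imports "Jordan_Normal_Form.Char_Poly" "HOL-Library.Disjoint_Sets"
begin

record 'a hypergraph =
  verts :: "'a set"
  edges :: "'a set set"

definition hypergraph :: "'a hypergraph \<Rightarrow> bool" where
  "hypergraph G \<longleftrightarrow> finite (verts G) \<and> verts G \<noteq> {} \<and>
     (\<forall>e\<in>edges G. e \<noteq> {} \<and> e \<subseteq> verts G)"

definition hypergraph_uniform :: "nat \<Rightarrow> 'a hypergraph \<Rightarrow> bool" where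
  "hypergraph_uniform k G \<longleftrightarrow> (\<forall>e\<in>edges G. card e = k)"

definition hypergraph_degree :: "'a hypergraph \<Rightarrow> 'a \<Rightarrow> nat" where
  "hypergraph_degree G x = card {e \<in> edges G. x \<in> e}"

text \<open>The walk \<open>(v\<^sub>0, e\<^sub>1, v\<^sub>1, \<dots>, e\<^sub>p, v\<^sub>p)\<close> is given by the two lists
  \<open>vs = [v\<^sub>0, \<dots>, v\<^sub>p]\<close> and \<open>es = [e\<^sub>1, \<dots>, e\<^sub>p]\<close>, so that \<open>e\<^sub>i\<close> is \<open>es ! (i - 1)\<close>.\<close>

definition hypergraph_walk :: "'a hypergraph \<Rightarrow> 'a \<Rightarrow> 'a list \<Rightarrow> 'a set list \<Rightarrow> 'a \<Rightarrow> bool" where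
  "hypergraph_walk G x vs es y \<longleftrightarrow>
     length vs = length es + 1 \<and> set vs \<subseteq> verts G \<and> set es \<subseteq> edges G \<and>
     hd vs = x \<and> last vs = y \<and>
     (\<forall>i<length es. vs ! i \<in> es ! i \<and> vs ! (i + 1) \<in> es ! i \<and> vs ! i \<noteq> vs ! (i + 1))"

definition hypergraph_path :: "'a hypergraph \<Rightarrow> 'a \<Rightarrow> 'a list \<Rightarrow> 'a set list \<Rightarrow> 'a \<Rightarrow> bool" where
  "hypergraph_path G x vs es y \<longleftrightarrow> hypergraph_walk G x vs es y \<and> distinct vs \<and> distinct es"

definition hypergraph_connected :: "'a hypergraph \<Rightarrow> bool" where
  "hypergraph_connected G \<longleftrightarrow> (\<forall>x\<in>verts G. \<forall>y\<in>verts G. \<exists>vs es. hypergraph_path G x vs es y)"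

text \<open>Only meaningful if there is a path from \<open>x\<close> to \<open>y\<close>, in particular if \<open>G\<close> is connected.\<close>

definition hypergraph_distance :: "'a hypergraph \<Rightarrow> 'a \<Rightarrow> 'a \<Rightarrow> nat" where
  "hypergraph_distance G x y = (LEAST p. \<exists>vs es. hypergraph_path G x vs es y \<and> length es = p)"

text \<open>Matrices are indexed by natural numbers, so the rows and columns of the distance matrix
  are ordered by an arbitrary enumeration of the vertices. Another enumeration conjugates the
  matrix by a permutation matrix; lemma \<open>eigenvalue_distance_matrix_iff\<close> shows that the
  eigenvalues do not depend on it.\<close>

definition vertex_list :: "'a hypergraph \<Rightarrow> 'a list" where
  "vertex_list G = (SOME xs. distinct xs \<and> set xs = verts G)"

definition distance_matrix :: "'a hypergraph \<Rightarrow> real mat" where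
  "distance_matrix G = (let xs = vertex_list G; n = length xs in
     mat n n (\<lambda>(i, j). real (hypergraph_distance G (xs ! i) (xs ! j))))"

text \<open>A real symmetric matrix has only real eigenvalues, so it suffices to look for the largest
  one among the reals.\<close>

definition distance_spectral_radius :: "'a hypergraph \<Rightarrow> real" where
  "distance_spectral_radius G = Max {l. eigenvalue (distance_matrix G) l}"

text \<open>The hypergraph \<open>G\<^bsub>e,s\<^esub>(H\<^sub>1, \<dots>, H\<^bsub>k-1\<^esub>)\<close>, where \<open>w 1, \<dots>, w k\<close> lists the vertices of
  \<open>e\<close>. Since the given hypergraphs are vertex-disjoint, the identifications are
  performed by renaming the root \<open>v i\<close> of \<open>H i\<close> to the vertex of \<open>G\<close> it is identified with.\<close>

definition attach_point :: "nat \<Rightarrow> (nat \<Rightarrow> 'a) \<Rightarrow> nat \<Rightarrow> nat \<Rightarrow> 'a" where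
  "attach_point k w s i = (if i \<le> s then w k else w i)"

definition rename_root :: "'a \<Rightarrow> 'a \<Rightarrow> 'a \<Rightarrow> 'a" where
  "rename_root r t x = (if x = r then t else x)"

definition attach_hypergraphs ::
  "nat \<Rightarrow> 'a hypergraph \<Rightarrow> (nat \<Rightarrow> 'a) \<Rightarrow> nat \<Rightarrow> (nat \<Rightarrow> 'a hypergraph) \<Rightarrow> (nat \<Rightarrow> 'a) \<Rightarrow> 'a hypergraph"
where
  "attach_hypergraphs k G w s H v =
     \<lparr>verts = verts G \<union>
        (\<Union>i\<in>{1..k - 1}. rename_root (v i) (attach_point k w s i) ` verts (H i)),
      edges = edges G \<union>
        (\<Union>i\<in>{1..k - 1}. (\<lambda>f. rename_root (v i) (attach_point k w s i) ` f) ` edges (H i))\<rparr>"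

lemma vertex_list:
  assumes "finite (verts G)"
  shows "distinct (vertex_list G)" "set (vertex_list G) = verts G"
proof -
  have "\<exists>xs. distinct xs \<and> set xs = verts G"
    using finite_distinct_list[OF assms] by blast
  then have "distinct (vertex_list G) \<and> set (vertex_list G) = verts G"
    unfolding vertex_list_def by (rule someI_ex)
  then show "distinct (vertex_list G)" "set (vertex_list G) = verts G" by auto
qed

lemma eigenvalue_distance_matrix_iff:
  assumes fin: "finite (verts G)"
  shows "eigenvalue (distance_matrix G) l \<longleftrightarrow>
    (\<exists>x. (\<exists>u\<in>verts G. x u \<noteq> 0) \<and>
         (\<forall>u\<in>verts G. (\<Sum>y\<in>verts G. real (hypergraph_distance G u y) * x y) = l * x u))"
proof -
  define xs where "xs = vertex_list G"
  define n where "n = length xs"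
  have d: "distinct xs" and s: "set xs = verts G"
    using vertex_list[OF fin] by (auto simp: xs_def)
  have bij: "bij_betw (\<lambda>i. xs ! i) {0..<n} (verts G)"
    using bij_betw_nth[OF d, of "{0..<n}" "verts G"] s n_def by (auto simp: lessThan_atLeast0)
  have D: "distance_matrix G = mat n n (\<lambda>(i, j). real (hypergraph_distance G (xs ! i) (xs ! j)))"
    by (simp add: distance_matrix_def xs_def n_def Let_def)
  have sums: "(\<Sum>y\<in>verts G. g y) = (\<Sum>j = 0..<n. g (xs ! j))" for g :: "'a \<Rightarrow> real"
    using sum.reindex_bij_betw[OF bij, of g] by simp
  have ball: "(\<forall>u\<in>verts G. P u) \<longleftrightarrow> (\<forall>i<n. P (xs ! i))" for P
    unfolding s[symmetric] n_def by (rule all_set_conv_all_nth)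
  have bex: "(\<exists>u\<in>verts G. P u) \<longleftrightarrow> (\<exists>i<n. P (xs ! i))" for P
    using ball[of "\<lambda>u. \<not> P u"] by blast
  have ev: "eigenvector (distance_matrix G) z l \<longleftrightarrow> z \<in> carrier_vec n \<and> (\<exists>i<n. z $ i \<noteq> 0) \<and>
      (\<forall>i<n. (\<Sum>j = 0..<n. real (hypergraph_distance G (xs ! i) (xs ! j)) * z $ j) = l * z $ i)" for z
  proof (cases "z \<in> carrier_vec n")
    case True
    have "z \<noteq> 0\<^sub>v n \<longleftrightarrow> (\<exists>i<n. z $ i \<noteq> 0)"
      using True by (auto simp: vec_eq_iff)
    moreover have "distance_matrix G *\<^sub>v z = l \<cdot>\<^sub>v z \<longleftrightarrow>
        (\<forall>i<n. (\<Sum>j = 0..<n. real (hypergraph_distance G (xs ! i) (xs ! j)) * z $ j) = l * z $ i)"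
      using True by (simp add: D vec_eq_iff scalar_prod_def)
    ultimately show ?thesis
      using True by (simp add: eigenvector_def D)
  qed (simp add: eigenvector_def D)
  show ?thesis
  proof
    assume "eigenvalue (distance_matrix G) l"
    then obtain z where z: "eigenvector (distance_matrix G) z l"
      by (auto simp: eigenvalue_def)
    define x where "x = (\<lambda>u. z $ (inv_into {0..<n} (\<lambda>i. xs ! i) u))"
    have x: "x (xs ! i) = z $ i" if "i < n" for i
      using bij that by (simp add: x_def bij_betw_def)
    show "\<exists>x. (\<exists>u\<in>verts G. x u \<noteq> 0) \<and>
        (\<forall>u\<in>verts G. (\<Sum>y\<in>verts G. real (hypergraph_distance G u y) * x y) = l * x u)"
      using z unfolding ev sums ball bex by (intro exI[of _ x]) (simp add: x cong: conj_cong)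
  next
    assume "\<exists>x. (\<exists>u\<in>verts G. x u \<noteq> 0) \<and>
        (\<forall>u\<in>verts G. (\<Sum>y\<in>verts G. real (hypergraph_distance G u y) * x y) = l * x u)"
    then obtain x where "\<exists>u\<in>verts G. x u \<noteq> 0"
      "\<forall>u\<in>verts G. (\<Sum>y\<in>verts G. real (hypergraph_distance G u y) * x y) = l * x u" by blast
    then have "eigenvector (distance_matrix G) (vec n (\<lambda>i. x (xs ! i))) l"
      unfolding ev sums ball bex by (simp cong: conj_cong)
    then show "eigenvalue (distance_matrix G) l" by (auto simp: eigenvalue_def)
  qed
qed

end

theory Submission
  imports Defs "HOL-Analysis.Function_Topology"
begin

text \<open>All the hypergraphs \<open>G\<^bsub>e,s\<^esub>(H\<^sub>1, \<dots>, H\<^bsub>k-1\<^esub>)\<close> have the same vertex set, and in each of them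
  distances are computed by passing through the attachment vertices. Let \<open>S\<close> consist of the
  non-root vertices of \<open>H\<^sub>1, \<dots>, H\<^sub>s\<close>, let \<open>R = V(G) - e\<close> and let \<open>x\<close> be a positive eigenvector for the
  spectral radius \<open>\<rho>\<close> at \<open>s\<close>. Going from \<open>s\<close> to \<open>0\<close>, the distance from a vertex of
  \<open>H\<^sub>i\<close> (\<open>i \<le> s\<close>) to \<open>R\<close> and \<open>w\<^sub>k\<close> grows by 1, the distance to \<open>w\<^sub>i\<close> drops by 1, and
  no other distance drops. With \<open>X\<close> and \<open>Y\<close> the sums of \<open>x\<close> over \<open>S\<close> and \<open>R\<close>, the quadratic form at
  \<open>x\<close> thus grows by at least twice the sum of \<open>x\<^sub>u (Y + x(w\<^sub>k) - x(w\<^sub>i))\<close> over \<open>u\<close> in \<open>S\<close>. Subtracting the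
  eigenvalue equations at \<open>w\<^sub>i\<close> and \<open>w\<^sub>k\<close> gives \<open>(\<rho> + 1)(x(w\<^sub>i) - x(w\<^sub>k)) = Y + X\<close>, so the
  bracket is \<open>(\<rho>Y - X) / (\<rho> + 1)\<close>, and this is positive by the eigenvalue equation at a vertex
  of \<open>R\<close>. The Rayleigh principle concludes.\<close>

section \<open>Distances\<close>

definition adjacent :: "'a hypergraph \<Rightarrow> 'a \<Rightarrow> 'a \<Rightarrow> bool" where
  "adjacent G x y \<longleftrightarrow> (\<exists>e\<in>edges G. x \<in> e \<and> y \<in> e \<and> x \<noteq> y)"

lemma adjacent_verts:
  assumes "hypergraph G" "adjacent G x y"
  shows "x \<in> verts G" "y \<in> verts G"
  using assms unfolding adjacent_def hypergraph_def by blast+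

lemma hypergraph_walk_nth:
  assumes "hypergraph_walk G x vs es y"
  shows "vs ! 0 = x" "vs ! length es = y"
proof -
  have l: "length vs = length es + 1" using assms by (simp add: hypergraph_walk_def)
  then have "vs \<noteq> []" by auto
  with l show "vs ! 0 = x" "vs ! length es = y"
    using assms hd_conv_nth[of vs] last_conv_nth[of vs] by (simp_all add: hypergraph_walk_def)
qed

lemma hypergraph_walk_adjacent:
  assumes "hypergraph_walk G x vs es y" "i < length es"
  shows "adjacent G (vs ! i) (vs ! Suc i)"
proof -
  have "es ! i \<in> edges G" using assms by (auto simp: hypergraph_walk_def)
  moreover have "vs ! i \<in> es ! i" "vs ! Suc i \<in> es ! i" "vs ! i \<noteq> vs ! Suc i"
    using assms unfolding hypergraph_walk_def by auto
  ultimately show ?thesis unfolding adjacent_def by blast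
qed

text \<open>A certificate for the distances from \<open>x\<close>: the Lipschitz condition bounds \<open>f\<close> by path lengths, and
  descending along \<open>f\<close> produces a walk that is automatically a path.\<close>

definition distance_potential :: "'a hypergraph \<Rightarrow> 'a \<Rightarrow> ('a \<Rightarrow> nat) \<Rightarrow> bool" where
  "distance_potential G x f \<longleftrightarrow> f x = 0 \<and>
     (\<forall>u y. adjacent G u y \<longrightarrow> f y \<le> f u + 1) \<and>
     (\<forall>y\<in>verts G. y \<noteq> x \<longrightarrow> (\<exists>u. adjacent G u y \<and> f y = f u + 1))"

lemma hypergraph_distance_eq_potential:
  assumes hyp: "hypergraph G" and x: "x \<in> verts G" and y: "y \<in> verts G"
    and pot: "distance_potential G x f"
  shows "hypergraph_distance G x y = f y"
proof -
  have fx: "f x = 0" and lip: "\<And>u y. adjacent G u y \<Longrightarrow> f y \<le> f u + 1"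
    and desc: "\<And>y. y \<in> verts G \<Longrightarrow> y \<noteq> x \<Longrightarrow> \<exists>u. adjacent G u y \<and> f y = f u + 1"
    using pot unfolding distance_potential_def by blast+
  \<comment> \<open>Prescribing the value \<open>i\<close> of \<open>f\<close> at position
    \<open>i\<close> is what makes the vertices, and then the edges, distinct below.\<close>
  have walk: "\<exists>vs es. hypergraph_walk G x vs es y \<and> length es = n \<and> (\<forall>i\<le>n. f (vs ! i) = i)"
    if "y \<in> verts G" "f y = n" for n y
    using that
  proof (induction n arbitrary: y)
    case 0
    then have "y = x" using desc[of y] by force
    then have "hypergraph_walk G x [x] [] y"
      using x by (simp add: hypergraph_walk_def)
    then show ?case using fx by (intro exI[of _ "[x]"] exI[of _ "[]"]) simp
  next
    case (Suc n)
    then have "y \<noteq> x" using fx by auto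
    then obtain u where u: "adjacent G u y" "f y = f u + 1" using desc Suc.prems by blast
    obtain vs es where w: "hypergraph_walk G x vs es u" "length es = n" "\<forall>i\<le>n. f (vs ! i) = i"
      using Suc.IH[of u] u Suc.prems adjacent_verts[OF hyp u(1)] by auto
    obtain g where g: "g \<in> edges G" "u \<in> g" "y \<in> g" "u \<noteq> y" using u by (auto simp: adjacent_def)
    have len: "length vs = Suc n" and ne: "vs \<noteq> []"
      using w by (auto simp: hypergraph_walk_def)
    have lastu: "vs ! n = u" using hypergraph_walk_nth(2)[OF w(1)] w(2) by simp
    have "hypergraph_walk G x (vs @ [y]) (es @ [g]) y"
      using w(1,2) g len ne lastu Suc.prems(1)
      unfolding hypergraph_walk_def by (auto simp: nth_append less_Suc_eq)
    moreover have "\<forall>i\<le>Suc n. f ((vs @ [y]) ! i) = i"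
      using w(3) len Suc.prems by (auto simp: nth_append le_Suc_eq)
    ultimately show ?case using w(2) by (intro exI[of _ "vs @ [y]"] exI[of _ "es @ [g]"]) simp
  qed
  obtain vs es where w: "hypergraph_walk G x vs es y" "length es = f y" "\<forall>i\<le>f y. f (vs ! i) = i"
    using walk[OF y refl] by blast
  have len: "length vs = Suc (f y)" using w by (simp add: hypergraph_walk_def)
  have "distinct vs"
    unfolding distinct_conv_nth using w(3) len by (metis less_Suc_eq_le)
  \<comment> \<open>An edge used at positions \<open>i < l\<close> would make \<open>vs ! i\<close>
    and \<open>vs ! (l + 1)\<close> adjacent, although their values under \<open>f\<close> differ by
    at least 2.\<close>
  moreover have "distinct es"
  proof -
    have "es ! i \<noteq> es ! l" if il: "i < l" "l < length es" for i l
    proof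
      assume eq: "es ! i = es ! l"
      have m: "vs ! i \<in> es ! i" "vs ! (l + 1) \<in> es ! l" "es ! i \<in> edges G"
        using w(1) il unfolding hypergraph_walk_def by auto
      have v: "f (vs ! i) = i" "f (vs ! (l + 1)) = l + 1" using w(2,3) il by auto
      then have "adjacent G (vs ! i) (vs ! (l + 1))"
        using m eq il unfolding adjacent_def by auto
      then show False using lip v il by fastforce
    qed
    then show ?thesis unfolding distinct_conv_nth by (metis nat_neq_iff)
  qed
  ultimately have path: "hypergraph_path G x vs es y" using w by (simp add: hypergraph_path_def)
  have lower: "f y \<le> length es'" if p: "hypergraph_path G x vs' es' y" for vs' es'
  proof -
    have wk: "hypergraph_walk G x vs' es' y" using p by (simp add: hypergraph_path_def)
    have "f (vs' ! i) \<le> i" if "i \<le> length es'" for i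
      using that
    proof (induction i)
      case 0
      show ?case using fx hypergraph_walk_nth(1)[OF wk] by simp
    next
      case (Suc i)
      then show ?case using lip[OF hypergraph_walk_adjacent[OF wk, of i]] by simp
    qed
    then show ?thesis using hypergraph_walk_nth(2)[OF wk] by fastforce
  qed
  show ?thesis
    unfolding hypergraph_distance_def
    by (rule Least_equality) (use path w(2) lower in auto)
qed

text \<open>The least number of adjacency steps from \<open>x\<close> is a potential: the last step
  of a shortest sequence raises it by exactly one. By the uniqueness just shown it equals the
  distance defined through paths, which thus inherits the property.\<close>

lemma distance_potential_hypergraph_distance:
  assumes hyp: "hypergraph G" and conn: "hypergraph_connected G" and x: "x \<in> verts G"
  shows "distance_potential G x (hypergraph_distance G x)"
proof -
  define f where "f y = (LEAST n. (adjacent G ^^ n) x y)" for y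
  have ex: "\<exists>n. (adjacent G ^^ n) x y" if "y \<in> verts G" for y
  proof -
    obtain vs es where p: "hypergraph_walk G x vs es y"
      using conn x \<open>y \<in> verts G\<close> unfolding hypergraph_connected_def hypergraph_path_def by blast
    then have "\<forall>i<length es. adjacent G (vs ! i) (vs ! Suc i)"
      using hypergraph_walk_adjacent by metis
    moreover have "vs ! 0 = x" "vs ! length es = y" using hypergraph_walk_nth[OF p] by auto
    ultimately show ?thesis unfolding relpowp_fun_conv by blast
  qed
  have f: "(adjacent G ^^ f y) x y" if "y \<in> verts G" for y
    unfolding f_def using ex[OF that] by (rule LeastI_ex)
  have f_le: "f y \<le> n" if "(adjacent G ^^ n) x y" for y n
    unfolding f_def using that by (rule Least_le)
  have f_lip: "f y \<le> f u + 1" if "adjacent G u y" for u y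
    using f_le[of "f u + 1" y] f[of u] adjacent_verts[OF hyp that] that by auto
  have pot: "distance_potential G x f"
    unfolding distance_potential_def
  proof (intro conjI allI impI ballI)
    show "f x = 0" using f_le[of 0 x] by simp
    show "f y \<le> f u + 1" if "adjacent G u y" for u y using f_lip that .
    fix y assume y: "y \<in> verts G" "y \<noteq> x"
    then obtain m where m: "f y = Suc m" using f[of y] by (cases "f y") auto
    then obtain u where u: "(adjacent G ^^ m) x u" "adjacent G u y" using f[OF y(1)] by auto
    have "f y = f u + 1" using f_lip[OF u(2)] f_le[OF u(1)] m by simp
    then show "\<exists>u. adjacent G u y \<and> f y = f u + 1" using u by blast
  qed
  have eq: "hypergraph_distance G x y = f y" if "y \<in> verts G" for y
    using hypergraph_distance_eq_potential[OF hyp x that pot] .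
  show ?thesis
    using pot adjacent_verts[OF hyp] x unfolding distance_potential_def
    by (metis eq)
qed

lemma
  assumes "hypergraph G" "hypergraph_connected G" "x \<in> verts G"
  shows hypergraph_distance_self: "hypergraph_distance G x x = 0"
    and hypergraph_distance_adjacent:
      "adjacent G u y \<Longrightarrow> hypergraph_distance G x y \<le> hypergraph_distance G x u + 1"
    and hypergraph_distance_descent: "y \<in> verts G \<Longrightarrow> y \<noteq> x \<Longrightarrow>
      \<exists>u. adjacent G u y \<and> hypergraph_distance G x y = hypergraph_distance G x u + 1"
  using distance_potential_hypergraph_distance[OF assms] unfolding distance_potential_def by auto

text \<open>Reversing both lists turns paths one way into paths the other way, so both minima range
  over the same set of lengths.\<close>

lemma hypergraph_distance_sym: "hypergraph_distance G x y = hypergraph_distance G y x"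
proof -
  have rev: "hypergraph_path G y (rev vs) (rev es) x" if p: "hypergraph_path G x vs es y"
    for x y vs es
  proof -
    have len: "length vs = length es + 1" and ne: "vs \<noteq> []"
      using p by (auto simp: hypergraph_path_def hypergraph_walk_def)
    have "rev vs ! i \<in> rev es ! i \<and> rev vs ! (i + 1) \<in> rev es ! i \<and> rev vs ! i \<noteq> rev vs ! (i + 1)"
      if i: "i < length es" for i
    proof -
      define l where "l = length es - Suc i"
      have l: "l < length es" and e: "rev es ! i = es ! l" and a: "rev vs ! i = vs ! (l + 1)"
        and b: "rev vs ! (i + 1) = vs ! l"
        using i len by (auto simp: l_def rev_nth Suc_diff_Suc)
      have "vs ! l \<in> es ! l \<and> vs ! (l + 1) \<in> es ! l \<and> vs ! l \<noteq> vs ! (l + 1)"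
        using p l by (simp add: hypergraph_path_def hypergraph_walk_def)
      then show ?thesis unfolding e a b by auto
    qed
    then show ?thesis
      using p ne by (simp add: hypergraph_path_def hypergraph_walk_def hd_rev last_rev)
  qed
  have "(\<exists>vs es. hypergraph_path G x vs es y \<and> length es = p) \<longleftrightarrow>
        (\<exists>vs es. hypergraph_path G y vs es x \<and> length es = p)" for p
    using rev by (metis length_rev)
  then show ?thesis unfolding hypergraph_distance_def by simp
qed

section \<open>Gluing rooted hypergraphs\<close>

text \<open>The attachment map \<open>a\<close> is arbitrary and may send several roots to one
  vertex, so the same distance formulas serve every value of \<open>s\<close>.\<close>

locale gluing =
  fixes G :: "'a hypergraph" and I :: "nat set" and H :: "nat \<Rightarrow> 'a hypergraph"
    and v :: "nat \<Rightarrow> 'a" and a :: "nat \<Rightarrow> 'a"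
  assumes finite_I: "finite I"
    and base: "hypergraph G" "hypergraph_connected G"
    and pieces: "\<And>i. i \<in> I \<Longrightarrow> hypergraph (H i)" "\<And>i. i \<in> I \<Longrightarrow> hypergraph_connected (H i)"
    and root: "\<And>i. i \<in> I \<Longrightarrow> v i \<in> verts (H i)"
    and base_disjoint: "\<And>i. i \<in> I \<Longrightarrow> verts G \<inter> verts (H i) = {}"
    and pieces_disjoint: "disjoint_family_on (\<lambda>i. verts (H i)) I"
    and target: "\<And>i. i \<in> I \<Longrightarrow> a i \<in> verts G"
begin

abbreviation ren :: "nat \<Rightarrow> 'a \<Rightarrow> 'a" where
  "ren i \<equiv> rename_root (v i) (a i)"

definition glue :: "'a hypergraph" where
  "glue = \<lparr>verts = verts G \<union> (\<Union>i\<in>I. ren i ` verts (H i)),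
           edges = edges G \<union> (\<Union>i\<in>I. (\<lambda>f. ren i ` f) ` edges (H i))\<rparr>"

text \<open>The definition does not involve \<open>a\<close>: interpretations that differ only in
  the attachment map share \<open>branch\<close>, and hence \<open>index\<close>.\<close>

definition branch :: "nat \<Rightarrow> 'a set" where
  "branch i = verts (H i) - {v i}"

definition index :: "'a \<Rightarrow> nat" where
  "index x = (THE i. i \<in> I \<and> x \<in> branch i)"

definition proj :: "'a \<Rightarrow> 'a" where
  "proj x = (if x \<in> verts G then x else a (index x))"

definition depth :: "'a \<Rightarrow> nat" where
  "depth x = (if x \<in> verts G then 0 else hypergraph_distance (H (index x)) (v (index x)) x)"

text \<open>Every route out of a branch passes its attachment vertex, so leaving a common branch
  gains nothing, and all other routes split into three legs. For two branches attached at the same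
  vertex the middle leg is 0.\<close>

definition glue_dist :: "'a \<Rightarrow> 'a \<Rightarrow> nat" where
  "glue_dist x y = (if \<exists>i\<in>I. x \<in> branch i \<and> y \<in> branch i
     then hypergraph_distance (H (index x)) x y
     else depth x + hypergraph_distance G (proj x) (proj y) + depth y)"

lemma branch_unique: "i \<in> I \<Longrightarrow> l \<in> I \<Longrightarrow> x \<in> branch i \<Longrightarrow> x \<in> branch l \<Longrightarrow> i = l"
  using pieces_disjoint unfolding disjoint_family_on_def branch_def by blast

lemma index: "i \<in> I \<Longrightarrow> x \<in> branch i \<Longrightarrow> index x = i"
  unfolding index_def using branch_unique by blast

lemma branch_base: "i \<in> I \<Longrightarrow> x \<in> branch i \<Longrightarrow> x \<notin> verts G"
  using base_disjoint unfolding branch_def by blast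

lemma proj_depth_base: "x \<in> verts G \<Longrightarrow> proj x = x" "x \<in> verts G \<Longrightarrow> depth x = 0"
  unfolding proj_def depth_def by auto

lemma proj_depth_branch:
  assumes "i \<in> I" "x \<in> branch i"
  shows "proj x = a i" "depth x = hypergraph_distance (H i) (v i) x"
  unfolding proj_def depth_def using branch_base[OF assms] index[OF assms] by auto

lemma ren_root [simp]: "ren i (v i) = a i"
  by (simp add: rename_root_def)

lemma ren_branch [simp]: "x \<in> branch i \<Longrightarrow> ren i x = x"
  by (auto simp: rename_root_def branch_def)

lemma ren_inj: "i \<in> I \<Longrightarrow> inj_on (ren i) (verts (H i))"
  using target base_disjoint unfolding inj_on_def rename_root_def by (metis disjoint_iff)

lemma verts_glue: "verts glue = verts G \<union> (\<Union>i\<in>I. branch i)"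
  using target root unfolding glue_def branch_def rename_root_def by (auto simp: image_iff)

lemma hypergraph_glue: "hypergraph glue"
proof -
  have "finite (verts glue)" "verts glue \<noteq> {}"
    using finite_I base pieces by (auto simp: glue_def hypergraph_def)
  moreover have "f \<noteq> {} \<and> f \<subseteq> verts glue" if "f \<in> edges glue" for f
    using that base(1) pieces(1) unfolding glue_def hypergraph_def by fastforce
  ultimately show ?thesis unfolding hypergraph_def by blast
qed

text \<open>Renaming is injective on each piece, so distinct vertices of a renamed edge come from
  distinct vertices and conversely.\<close>

lemma adjacent_glue:
  "adjacent glue u y \<longleftrightarrow> adjacent G u y \<or>
     (\<exists>i\<in>I. \<exists>u' y'. adjacent (H i) u' y' \<and> u = ren i u' \<and> y = ren i y')"
proof -
  have 1: "adjacent (H i) u' y' \<Longrightarrow> i \<in> I \<Longrightarrow> ren i u' \<noteq> ren i y'" for i u' y'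
    using ren_inj[of i] adjacent_verts[OF pieces(1), of i u' y']
    by (auto simp: inj_on_def adjacent_def)
  show ?thesis
  proof
    assume "adjacent glue u y"
    then obtain f where f: "f \<in> edges glue" "u \<in> f" "y \<in> f" "u \<noteq> y"
      unfolding adjacent_def by blast
    then consider "f \<in> edges G" | i g where "i \<in> I" "g \<in> edges (H i)" "f = ren i ` g"
      unfolding glue_def by auto
    then show "adjacent G u y \<or>
     (\<exists>i\<in>I. \<exists>u' y'. adjacent (H i) u' y' \<and> u = ren i u' \<and> y = ren i y')"
    proof cases
      case 1
      then show ?thesis using f unfolding adjacent_def by blast
    next
      case 2
      then obtain u' y' where "u' \<in> g" "y' \<in> g" "u = ren i u'" "y = ren i y'" using f by blast
      moreover from this have "adjacent (H i) u' y'" using f 2 unfolding adjacent_def by blast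
      ultimately show ?thesis using 2(1) by blast
    qed
  next
    assume "adjacent G u y \<or>
     (\<exists>i\<in>I. \<exists>u' y'. adjacent (H i) u' y' \<and> u = ren i u' \<and> y = ren i y')"
    then show "adjacent glue u y"
    proof
      assume "adjacent G u y"
      then show ?thesis unfolding adjacent_def glue_def by auto
    next
      assume "\<exists>i\<in>I. \<exists>u' y'. adjacent (H i) u' y' \<and> u = ren i u' \<and> y = ren i y'"
      then obtain i u' y' where i: "i \<in> I" "adjacent (H i) u' y'" "u = ren i u'" "y = ren i y'"
        by blast
      then obtain f where "f \<in> edges (H i)" "u' \<in> f" "y' \<in> f" unfolding adjacent_def by blast
      then have "ren i ` f \<in> edges glue" "u \<in> ren i ` f" "y \<in> ren i ` f"
        using i unfolding glue_def by auto
      moreover have "u \<noteq> y" using 1[OF i(2,1)] i(3,4) by simp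
      ultimately show ?thesis unfolding adjacent_def by blast
    qed
  qed
qed

lemma glue_dist_base:
  assumes "y \<in> verts G"
  shows "glue_dist x y = depth x + hypergraph_distance G (proj x) y"
  using assms branch_base by (auto simp: glue_dist_def proj_depth_base)

text \<open>This treats the root of \<open>H i\<close> like its other vertices. Seen from
  \<open>x\<close>, the whole piece carries the distances from \<open>x\<close> itself or, up to a
  constant, those from the root.\<close>

lemma glue_dist_ren:
  assumes i: "i \<in> I" and y: "y \<in> verts (H i)" and x: "x \<in> verts glue"
  shows "glue_dist x (ren i y) = (if x \<in> branch i then hypergraph_distance (H i) x y
     else depth x + hypergraph_distance G (proj x) (a i) + hypergraph_distance (H i) (v i) y)"
proof (cases "y = v i")
  case True
  then have "glue_dist x (ren i y) = depth x + hypergraph_distance G (proj x) (a i)"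
    using glue_dist_base[of "a i" x] target[OF i] by simp
  moreover have "hypergraph_distance G (a i) (a i) = 0"
    by (rule hypergraph_distance_self) (use base target i in auto)
  moreover have "hypergraph_distance (H i) (v i) (v i) = 0"
    by (rule hypergraph_distance_self) (use pieces root i in auto)
  ultimately show ?thesis
    using True i by (simp add: proj_depth_branch hypergraph_distance_sym[of "H i" x])
next
  case False
  then have y': "y \<in> branch i" using y by (simp add: branch_def)
  have "(\<exists>l\<in>I. x \<in> branch l \<and> y \<in> branch l) \<longleftrightarrow> x \<in> branch i"
    using branch_unique y' i by blast
  then show ?thesis
    using y' i by (simp add: glue_dist_def index proj_depth_branch)
qed

lemma proj_verts: "x \<in> verts glue \<Longrightarrow> proj x \<in> verts G"
  using verts_glue target proj_depth_base proj_depth_branch by force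

text \<open>On \<open>G\<close> the function is the distance from \<open>proj x\<close> plus a
  constant, and on each piece the distance from \<open>x\<close> or from the root plus a constant.
  Since every adjacency lies in \<open>G\<close> or in one piece, both conditions carry over from
  there.\<close>

lemma distance_potential_glue_dist:
  assumes x: "x \<in> verts glue"
  shows "distance_potential glue x (glue_dist x)"
proof -
  note px = proj_verts[OF x]
  have "glue_dist x x = 0"
  proof (cases "x \<in> verts G")
    case True
    then show ?thesis
      using glue_dist_base[OF True, of x] hypergraph_distance_self[OF base True]
      by (simp add: proj_depth_base)
  next
    case False
    then obtain i where i: "i \<in> I" "x \<in> branch i" using x verts_glue by blast
    then have "x \<in> verts (H i)" by (simp add: branch_def)
    then show ?thesis
      using glue_dist_ren[OF i(1) _ x, of x] i hypergraph_distance_self[of "H i" x] pieces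
      by simp
  qed
  moreover have "glue_dist x y \<le> glue_dist x u + 1" if adj: "adjacent glue u y" for u y
  proof -
    consider "adjacent G u y" | i u' y' where "i \<in> I" "adjacent (H i) u' y'" "u = ren i u'" "y = ren i y'"
      using adj unfolding adjacent_glue by blast
    then show ?thesis
    proof cases
      case 1
      then show ?thesis
        using glue_dist_base adjacent_verts[OF base(1) 1] hypergraph_distance_adjacent[OF base px 1]
        by simp
    next
      case 2
      have vs: "u' \<in> verts (H i)" "y' \<in> verts (H i)"
        using adjacent_verts[OF pieces(1)] 2 by blast+
      have L: "hypergraph_distance (H i) z y' \<le> hypergraph_distance (H i) z u' + 1"
        if "z \<in> verts (H i)" for z
        using hypergraph_distance_adjacent[OF pieces(1) pieces(2) that 2(2)] 2 by blast
      show ?thesis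
        using L[of x] L[of "v i"] root[OF 2(1)] vs 2 x
        by (auto simp: glue_dist_ren branch_def)
    qed
  qed
  moreover have "\<exists>u. adjacent glue u y \<and> glue_dist x y = glue_dist x u + 1"
    if y: "y \<in> verts glue" "y \<noteq> x" for y
  proof -
    \<comment> \<open>Descent inside piece \<open>i\<close> heads for \<open>x\<close> if
      \<open>x\<close> lies in that branch, and for the root otherwise.\<close>
    have desc: "\<exists>u. adjacent glue u (ren i y') \<and> glue_dist x (ren i y') = glue_dist x u + 1"
      if i: "i \<in> I" and y': "y' \<in> verts (H i)" and z: "y' \<noteq> (if x \<in> branch i then x else v i)"
      for i y'
    proof -
      define z where "z = (if x \<in> branch i then x else v i)"
      have "z \<in> verts (H i)" using root i by (auto simp: z_def branch_def)
      then obtain u where u: "adjacent (H i) u y'"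
        "hypergraph_distance (H i) z y' = hypergraph_distance (H i) z u + 1"
        using hypergraph_distance_descent[of "H i" z y'] y' z pieces i unfolding z_def by blast
      have "u \<in> verts (H i)" using adjacent_verts[OF pieces(1)] i u by blast
      then have "glue_dist x (ren i y') = glue_dist x (ren i u) + 1"
        using u(2) y' i x by (simp add: glue_dist_ren z_def split: if_splits)
      then show ?thesis using u(1) i adjacent_glue by blast
    qed
    show ?thesis
    proof (cases "y \<in> verts G")
      case True
      show ?thesis
      proof (cases "y = proj x")
        case False
        then obtain u where u: "adjacent G u y"
          "hypergraph_distance G (proj x) y = hypergraph_distance G (proj x) u + 1"
          using hypergraph_distance_descent[OF base px True] by blast
        then have "glue_dist x y = glue_dist x u + 1"
          using glue_dist_base True adjacent_verts[OF base(1) u(1)] by simp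
        then show ?thesis using u(1) adjacent_glue by blast
      next
        \<comment> \<open>Here \<open>y\<close> is the attachment vertex of the branch of
          \<open>x\<close>, so no descent within \<open>G\<close> is left; the next step enters that
          branch from its root.\<close>
        case pxy: True
        then have "x \<notin> verts G" using y proj_depth_base by auto
        then obtain i where i: "i \<in> I" "x \<in> branch i" using x verts_glue by blast
        then have "y = ren i (v i)" using pxy proj_depth_branch by simp
        then show ?thesis using desc[OF i(1) root[OF i(1)]] i by (auto simp: branch_def)
      qed
    next
      case False
      then obtain i where i: "i \<in> I" "y \<in> branch i" using y verts_glue by blast
      then have "y \<in> verts (H i)" "y \<noteq> v i" by (auto simp: branch_def)
      then show ?thesis using desc[OF i(1), of y] i y(2) by auto
    qed
  qed
  ultimately show ?thesis unfolding distance_potential_def by blast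
qed

lemma hypergraph_distance_glue:
  "x \<in> verts glue \<Longrightarrow> y \<in> verts glue \<Longrightarrow> hypergraph_distance glue x y = glue_dist x y"
  by (rule hypergraph_distance_eq_potential[OF hypergraph_glue _ _ distance_potential_glue_dist])

lemma hypergraph_distance_glue_pos:
  assumes "x \<in> verts glue" "y \<in> verts glue" "x \<noteq> y"
  shows "1 \<le> hypergraph_distance glue x y"
  using distance_potential_glue_dist[OF assms(1)] assms
  by (auto simp: hypergraph_distance_glue distance_potential_def)

lemma hypergraph_distance_glue_base:
  assumes "x \<in> verts G" "y \<in> verts G"
  shows "hypergraph_distance glue x y = hypergraph_distance G x y"
  using assms by (simp add: hypergraph_distance_glue verts_glue glue_dist_base proj_depth_base)

lemma hypergraph_distance_glue_branch_base:
  assumes "i \<in> I" "x \<in> branch i" "y \<in> verts G"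
  shows "hypergraph_distance glue x y = hypergraph_distance (H i) (v i) x + hypergraph_distance G (a i) y"
proof -
  have "x \<in> verts glue" "y \<in> verts glue" using assms verts_glue by auto
  then show ?thesis
    using assms(3) proj_depth_branch[OF assms(1,2)]
    by (simp add: hypergraph_distance_glue glue_dist_base)
qed

lemma hypergraph_distance_glue_same_branch:
  assumes "i \<in> I" "x \<in> branch i" "y \<in> branch i"
  shows "hypergraph_distance glue x y = hypergraph_distance (H i) x y"
proof -
  have "x \<in> verts glue" "y \<in> verts glue" "y \<in> verts (H i)"
    using assms verts_glue by (auto simp: branch_def)
  then show ?thesis
    using glue_dist_ren[OF assms(1), of y x] assms by (simp add: hypergraph_distance_glue)
qed

lemma hypergraph_distance_glue_branches:
  assumes "i \<in> I" "l \<in> I" "i \<noteq> l" "x \<in> branch i" "y \<in> branch l"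
  shows "hypergraph_distance glue x y =
    hypergraph_distance (H i) (v i) x + hypergraph_distance G (a i) (a l) + hypergraph_distance (H l) (v l) y"
proof -
  have "x \<notin> branch l" using assms branch_unique by blast
  moreover have "y \<in> verts (H l)" "x \<in> verts glue" "y \<in> verts glue"
    using assms verts_glue by (auto simp: branch_def)
  ultimately show ?thesis
    using glue_dist_ren[of l y x] assms proj_depth_branch[of i x]
    by (simp add: hypergraph_distance_glue)
qed

end

section \<open>The Rayleigh principle\<close>

definition quad_form :: "'a set \<Rightarrow> ('a \<Rightarrow> 'a \<Rightarrow> real) \<Rightarrow> ('a \<Rightarrow> real) \<Rightarrow> real" where
  "quad_form V d x = (\<Sum>u\<in>V. \<Sum>y\<in>V. d u y * x u * x y)"

lemma quad_form_eigenvector: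
  assumes "\<forall>u\<in>V. (\<Sum>y\<in>V. d u y * x y) = l * x u"
  shows "quad_form V d x = l * (\<Sum>u\<in>V. (x u)\<^sup>2)"
proof -
  have "quad_form V d x = (\<Sum>u\<in>V. x u * (\<Sum>y\<in>V. d u y * x y))"
    unfolding quad_form_def sum_distrib_left by (intro sum.cong refl) (simp add: mult_ac)
  also have "\<dots> = (\<Sum>u\<in>V. l * (x u)\<^sup>2)"
    using assms by (intro sum.cong refl) (simp add: power2_eq_square)
  finally show ?thesis by (simp add: sum_distrib_left)
qed

text \<open>The polynomial attains its minimum 0 at \<open>t = 0\<close>, so its derivative
  \<open>b\<close> there vanishes. This is the first-order condition for the maximizer
  below.\<close>

lemma linear_term_zero:
  fixes a b :: real
  assumes "\<And>t. a * t\<^sup>2 + b * t \<ge> 0"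
  shows "b = 0"
proof (rule ccontr)
  assume b: "b \<noteq> 0"
  \<comment> \<open>the minimizer, with \<open>a\<close> replaced by a positive upper bound\<close>
  define t where "t = - b / (2 * (\<bar>a\<bar> + 1))"
  have "2 * (\<bar>a\<bar> + 1) \<noteq> 0" using abs_ge_zero[of a] by (simp add: add_nonneg_eq_0_iff)
  then have "t * (2 * (\<bar>a\<bar> + 1)) = - b" by (simp add: t_def)
  then have "t * t * (2 * (\<bar>a\<bar> + 1)) = - b * t" by (simp add: mult.assoc)
  then have "2 * (\<bar>a\<bar> * t\<^sup>2) + 2 * t\<^sup>2 = - (b * t)"
    by (simp add: power2_eq_square algebra_simps)
  moreover have "t\<^sup>2 > 0" using b \<open>2 * (\<bar>a\<bar> + 1) \<noteq> 0\<close> by (simp add: t_def)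
  moreover have "a * t\<^sup>2 \<le> \<bar>a\<bar> * t\<^sup>2" by (simp add: mult_right_mono)
  moreover have "\<bar>a\<bar> * t\<^sup>2 \<ge> 0" by simp
  ultimately have "a * t\<^sup>2 + b * t < 0" by linarith
  then show False using assms[of t] by simp
qed

text \<open>A continuous function attains its maximum on the compact unit sphere, and scaling
  extends the bound to all \<open>z\<close>.\<close>

lemma quad_form_maximizer_exists:
  assumes fin: "finite V" and ne: "V \<noteq> {}"
  shows "\<exists>x. (\<Sum>u\<in>V. (x u)\<^sup>2) = 1 \<and>
           (\<forall>z. quad_form V d z \<le> quad_form V d x * (\<Sum>u\<in>V. (z u)\<^sup>2))"
proof -
  define N where "N x = (\<Sum>u\<in>V. (x u)\<^sup>2)" for x :: "'a \<Rightarrow> real"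
  \<comment> \<open>Functions live on the whole type, so the coordinates outside \<open>V\<close>
    are pinned to 0; the box is then compact by Tychonoff's theorem.\<close>
  define B :: "('a \<Rightarrow> real) set" where
    "B = (\<Pi>\<^sub>E u\<in>UNIV. if u \<in> V then {-1..1} else {0})"
  have "compactin (product_topology (\<lambda>_. euclidean) UNIV) B"
    unfolding B_def compactin_PiE by (auto simp: compactin_euclidean_iff)
  then have "compact B" by (simp add: euclidean_product_topology)
  moreover have "closed {x. N x = 1}"
    unfolding N_def by (intro closed_Collect_eq continuous_intros continuous_on_product_coordinates)
  ultimately have comp: "compact (B \<inter> {x. N x = 1})" by (rule compact_Int_closed)
  have normalized: "(\<lambda>u. if u \<in> V then z u / sqrt (N z) else 0) \<in> B \<inter> {x. N x = 1}"
    if "N z > 0" for z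
  proof -
    have "\<bar>z u\<bar> \<le> sqrt (N z)" if "u \<in> V" for u
    proof -
      have "(z u)\<^sup>2 \<le> N z" unfolding N_def using fin that by (intro member_le_sum) auto
      then show ?thesis by (metis real_sqrt_abs real_sqrt_le_iff)
    qed
    then have "- 1 \<le> z u / sqrt (N z) \<and> z u / sqrt (N z) \<le> 1" if "u \<in> V" for u
      using \<open>N z > 0\<close> that by (simp add: field_simps abs_le_iff) (metis minus_le_iff)
    moreover have "N (\<lambda>u. if u \<in> V then z u / sqrt (N z) else 0) = (\<Sum>u\<in>V. (z u)\<^sup>2 / N z)"
      unfolding N_def[of "\<lambda>u. if u \<in> V then z u / sqrt (N z) else 0"]
      using \<open>N z > 0\<close> by (intro sum.cong) (auto simp: power_divide)
    then have "N (\<lambda>u. if u \<in> V then z u / sqrt (N z) else 0) = 1"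
      using \<open>N z > 0\<close> by (simp add: sum_divide_distrib[symmetric] N_def)
    ultimately show ?thesis by (auto simp: B_def)
  qed
  have "N (\<lambda>_. 1) > 0" using fin ne by (simp add: N_def card_gt_0_iff)
  then have nonempty: "B \<inter> {x. N x = 1} \<noteq> {}" using normalized by blast
  have "continuous_on (B \<inter> {x. N x = 1}) (quad_form V d)"
    unfolding quad_form_def
    by (rule continuous_on_subset[OF _ subset_UNIV])
      (intro continuous_intros continuous_on_product_coordinates)
  then obtain x where x: "x \<in> B \<inter> {x. N x = 1}"
    and max: "\<forall>y\<in>B \<inter> {x. N x = 1}. quad_form V d y \<le> quad_form V d x"
    using continuous_attains_sup[OF comp nonempty] by blast
  \<comment> \<open>If the norm of \<open>z\<close> is 0, then \<open>z\<close> vanishes on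
    \<open>V\<close> and both sides are 0; otherwise homogeneity of degree 2 reduces
    \<open>z\<close> to the sphere.\<close>
  have "quad_form V d z \<le> quad_form V d x * N z" for z
  proof (cases "N z = 0")
    case True
    then have "\<forall>u\<in>V. z u = 0" using fin by (simp add: N_def sum_nonneg_eq_0_iff)
    then show ?thesis using True by (simp add: quad_form_def)
  next
    case False
    then have pos: "N z > 0" unfolding N_def by (metis less_eq_real_def sum_nonneg zero_le_power2)
    have "quad_form V d (\<lambda>u. if u \<in> V then z u / sqrt (N z) else 0)
        = (\<Sum>u\<in>V. \<Sum>y\<in>V. d u y * z u * z y / N z)"
      unfolding quad_form_def using pos by (intro sum.cong refl) (simp add: field_simps)
    also have "\<dots> = quad_form V d z / N z"
      by (simp add: quad_form_def sum_divide_distrib)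
    finally have "quad_form V d z / N z \<le> quad_form V d x" using max normalized[OF pos] by metis
    then show ?thesis using pos by (simp add: divide_le_eq)
  qed
  then show ?thesis using x unfolding N_def by blast
qed

text \<open>Changing \<open>x\<close> by \<open>t\<close> in the coordinate \<open>u\<close> makes
  the slack in \<open>max\<close> a nonnegative quadratic polynomial in \<open>t\<close> without
  constant term. Its linear coefficient must vanish, and this is the eigenvalue equation at
  \<open>u\<close>.\<close>

lemma quad_form_maximizer_eigenvector:
  assumes fin: "finite V" and sym: "\<And>u y. u \<in> V \<Longrightarrow> y \<in> V \<Longrightarrow> d u y = d y u"
    and max: "\<And>z. quad_form V d z \<le> m * (\<Sum>u\<in>V. (z u)\<^sup>2)"
    and attained: "quad_form V d x = m * (\<Sum>u\<in>V. (x u)\<^sup>2)"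
  shows "\<forall>u\<in>V. (\<Sum>y\<in>V. d u y * x y) = m * x u"
proof
  fix u assume u: "u \<in> V"
  have "(m - d u u) * t\<^sup>2 + 2 * (m * x u - (\<Sum>y\<in>V. d u y * x y)) * t \<ge> 0" for t
  proof -
    define \<delta> where "\<delta> y = (if y = u then 1 else 0 :: real)" for y
    define z where "z y = x y + t * \<delta> y" for y
    have one: "(\<Sum>y\<in>V. h y * \<delta> y) = h u" for h
      using fin u by (simp add: \<delta>_def if_distrib cong: if_cong)
    have "(\<Sum>y\<in>V. (z y)\<^sup>2) = (\<Sum>y\<in>V. (x y)\<^sup>2 + 2 * t * x y * \<delta> y + t\<^sup>2 * \<delta> y * \<delta> y)"
      by (intro sum.cong refl) (simp add: z_def power2_eq_square algebra_simps)
    also have "\<dots> = (\<Sum>y\<in>V. (x y)\<^sup>2) + 2 * t * x u + t\<^sup>2"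
      by (simp add: sum.distrib one) (simp add: \<delta>_def)
    finally have N: "(\<Sum>y\<in>V. (z y)\<^sup>2) = (\<Sum>y\<in>V. (x y)\<^sup>2) + 2 * t * x u + t\<^sup>2" .
    have "quad_form V d z = (\<Sum>a\<in>V. \<Sum>b\<in>V. d a b * x a * x b + (t * d a b * x a) * \<delta> b
        + (t * d a b * x b) * \<delta> a + t\<^sup>2 * d a b * \<delta> a * \<delta> b)"
      unfolding quad_form_def
      by (intro sum.cong refl) (simp add: z_def power2_eq_square algebra_simps)
    also have "\<dots> = quad_form V d x + (\<Sum>a\<in>V. t * d a u * x a)
        + (\<Sum>a\<in>V. (\<Sum>b\<in>V. t * d a b * x b) * \<delta> a) + (\<Sum>a\<in>V. t\<^sup>2 * d a u * \<delta> a)"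
      by (simp add: sum.distrib one quad_form_def sum_distrib_right)
    also have "\<dots> = quad_form V d x + (\<Sum>a\<in>V. t * d u a * x a)
        + (\<Sum>b\<in>V. t * d u b * x b) + t\<^sup>2 * d u u"
      using sym u by (simp add: one)
    also have "\<dots> = quad_form V d x + 2 * t * (\<Sum>y\<in>V. d u y * x y) + t\<^sup>2 * d u u"
      by (simp add: sum_distrib_left mult_ac)
    finally show ?thesis using max[of z] attained unfolding N by (simp add: algebra_simps)
  qed
  from linear_term_zero[OF this] show "(\<Sum>y\<in>V. d u y * x y) = m * x u" by simp
qed

text \<open>Replacing a maximizer by its absolute values keeps the norm and, as \<open>d\<close> is
  nonnegative, does not lower the form. This is the existence half of the Perron-Frobenius theorem
  for symmetric matrices.\<close>

lemma quad_form_nonneg_maximizer: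
  assumes fin: "finite V" and ne: "V \<noteq> {}"
    and sym: "\<And>u y. u \<in> V \<Longrightarrow> y \<in> V \<Longrightarrow> d u y = d y u"
    and nonneg: "\<And>u y. u \<in> V \<Longrightarrow> y \<in> V \<Longrightarrow> 0 \<le> d u y"
  obtains x m where "\<And>u. 0 \<le> x u" "\<exists>u\<in>V. x u \<noteq> 0"
    "\<forall>u\<in>V. (\<Sum>y\<in>V. d u y * x y) = m * x u"
    "\<And>z. quad_form V d z \<le> m * (\<Sum>u\<in>V. (z u)\<^sup>2)"
proof -
  obtain x where x: "(\<Sum>u\<in>V. (x u)\<^sup>2) = 1"
    and max: "\<And>z. quad_form V d z \<le> quad_form V d x * (\<Sum>u\<in>V. (z u)\<^sup>2)"
    using quad_form_maximizer_exists[OF fin ne, of d] by blast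
  define y where "y u = \<bar>x u\<bar>" for u
  have Ny: "(\<Sum>u\<in>V. (y u)\<^sup>2) = 1" using x by (simp add: y_def)
  have "quad_form V d x \<le> quad_form V d y"
    unfolding quad_form_def
  proof (intro sum_mono)
    fix a b assume "a \<in> V" "b \<in> V"
    then have "d a b * (x a * x b) \<le> d a b * (y a * y b)"
      using nonneg by (intro mult_left_mono) (auto simp: y_def abs_mult[symmetric])
    then show "d a b * x a * x b \<le> d a b * y a * y b" by (simp add: mult_ac)
  qed
  then have "quad_form V d y = quad_form V d x * (\<Sum>u\<in>V. (y u)\<^sup>2)"
    using max[of y] Ny by simp
  then have eig: "\<forall>u\<in>V. (\<Sum>w\<in>V. d u w * y w) = quad_form V d x * y u"
    using quad_form_maximizer_eigenvector[OF fin sym max] by blast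
  have nz: "\<exists>u\<in>V. y u \<noteq> 0"
    using Ny by (metis (no_types, lifting) sum.neutral zero_neq_one zero_power2)
  show ?thesis by (rule that[OF _ nz eig max]) (simp add: y_def)
qed

lemma
  fixes G :: "'a hypergraph"
  defines "d u y \<equiv> real (hypergraph_distance G u y)"
  assumes fin: "finite (verts G)" and ne: "verts G \<noteq> {}"
  shows distance_spectral_radius_nonneg_eigenvector:
      "\<exists>x. (\<forall>u. 0 \<le> x u) \<and> (\<exists>u\<in>verts G. x u \<noteq> 0) \<and>
         (\<forall>u\<in>verts G. (\<Sum>y\<in>verts G. d u y * x y) = distance_spectral_radius G * x u)"
    and quad_form_le_distance_spectral_radius:
      "quad_form (verts G) d z \<le> distance_spectral_radius G * (\<Sum>u\<in>verts G. (z u)\<^sup>2)"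
proof -
  obtain x m where x: "\<And>u. 0 \<le> x u" "\<exists>u\<in>verts G. x u \<noteq> 0"
    "\<forall>u\<in>verts G. (\<Sum>y\<in>verts G. d u y * x y) = m * x u"
    "\<And>z. quad_form (verts G) d z \<le> m * (\<Sum>u\<in>verts G. (z u)\<^sup>2)"
    by (rule quad_form_nonneg_maximizer[OF fin ne, of d])
      (auto simp: d_def hypergraph_distance_sym)
  define n where "n = length (vertex_list G)"
  have D: "distance_matrix G \<in> carrier_mat n n"
    by (simp add: distance_matrix_def n_def Let_def)
  \<comment> \<open>The spectrum is the zero set of the characteristic polynomial, hence finite, so
    that \<open>Max\<close> is meaningful. Every eigenvalue is the Rayleigh quotient of its
    eigenvector and thus at most \<open>m\<close>.\<close>
  have "{l. eigenvalue (distance_matrix G) l} = {l. poly (char_poly (distance_matrix G)) l = 0}"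
    using eigenvalue_root_char_poly[OF D] by simp
  moreover have "char_poly (distance_matrix G) \<noteq> 0"
    using degree_monic_char_poly[OF D] by auto
  ultimately have "finite {l. eigenvalue (distance_matrix G) l}"
    by (simp add: poly_roots_finite)
  moreover have "eigenvalue (distance_matrix G) m"
    unfolding eigenvalue_distance_matrix_iff[OF fin] using x(2,3) unfolding d_def by blast
  moreover have "l \<le> m" if l: "eigenvalue (distance_matrix G) l" for l
  proof -
    obtain z where z: "\<exists>u\<in>verts G. z u \<noteq> 0"
      "\<forall>u\<in>verts G. (\<Sum>y\<in>verts G. d u y * z y) = l * z u"
      using l unfolding eigenvalue_distance_matrix_iff[OF fin] d_def by blast
    then have "l * (\<Sum>u\<in>verts G. (z u)\<^sup>2) \<le> m * (\<Sum>u\<in>verts G. (z u)\<^sup>2)"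
      using x(4)[of z] quad_form_eigenvector by metis
    moreover have "(\<Sum>u\<in>verts G. (z u)\<^sup>2) > 0"
      using z(1) fin by (auto intro: sum_pos2)
    ultimately show ?thesis by simp
  qed
  ultimately have "distance_spectral_radius G = m"
    unfolding distance_spectral_radius_def by (intro Max_eqI) auto
  then show "\<exists>x. (\<forall>u. 0 \<le> x u) \<and> (\<exists>u\<in>verts G. x u \<noteq> 0) \<and>
         (\<forall>u\<in>verts G. (\<Sum>y\<in>verts G. d u y * x y) = distance_spectral_radius G * x u)"
    and "quad_form (verts G) d z \<le> distance_spectral_radius G * (\<Sum>u\<in>verts G. (z u)\<^sup>2)"
    using x by blast+
qed

text \<open>\<open>S\<close> and \<open>R\<close> play the role described at the beginning, \<open>c = w k\<close>, and \<open>q u = w i\<close> if \<open>u\<close> belongs to \<open>H i\<close>.\<close>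

lemma quad_form_eigenvalue_less:
  fixes d d' :: "'a \<Rightarrow> 'a \<Rightarrow> real" and q :: "'a \<Rightarrow> 'a" and S R :: "'a set" and c :: 'a
  defines "g u y \<equiv> of_bool (u \<in> S) * (of_bool (y \<in> R) + of_bool (y = c) - of_bool (y = q u)) :: real"
  assumes fin: "finite V" and dist: "\<And>u y. u \<in> V \<Longrightarrow> y \<in> V \<Longrightarrow> u \<noteq> y \<Longrightarrow> 1 \<le> d u y"
    and nonneg: "\<And>u y. u \<in> V \<Longrightarrow> y \<in> V \<Longrightarrow> 0 \<le> d u y"
    and x: "\<And>u. 0 \<le> x u" "\<exists>u\<in>V. x u \<noteq> 0"
    and eig: "\<forall>u\<in>V. (\<Sum>y\<in>V. d u y * x y) = m * x u"
    and max': "\<And>z. quad_form V d' z \<le> m' * (\<Sum>u\<in>V. (z u)\<^sup>2)"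
    and S: "S \<subseteq> V" "S \<noteq> {}" and R: "R \<subseteq> V" "R \<noteq> {}" and c: "c \<in> V"
    and disj: "S \<inter> R = {}" "c \<notin> S" "c \<notin> R"
    and q: "\<And>u. u \<in> S \<Longrightarrow> q u \<in> V"
    and twin: "\<And>u y. u \<in> S \<Longrightarrow> y \<in> V \<Longrightarrow>
      d (q u) y = d c y + of_bool (y \<in> R) + of_bool (y \<in> S) + of_bool (y = c) - of_bool (y = q u)"
    and increase: "\<And>u y. u \<in> V \<Longrightarrow> y \<in> V \<Longrightarrow> d' u y \<ge> d u y + g u y + g y u"
  shows "m < m'"
proof -
  obtain u0 where u0: "u0 \<in> V" "x u0 > 0" using x by (metis less_eq_real_def)
  \<comment> \<open>The term for \<open>u0\<close> alone makes the left side of the eigenvalue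
    equation at \<open>u\<close> positive; \<open>u0\<close> is excluded because the diagonal of
    \<open>d\<close> may be 0.\<close>
  have pos: "m * x u > 0" if u: "u \<in> V" "u \<noteq> u0" for u
  proof -
    have "0 < 1 * x u0" using u0 by simp
    also have "\<dots> \<le> d u u0 * x u0" using dist[of u u0] u u0 by (intro mult_right_mono) auto
    also have "\<dots> \<le> (\<Sum>y\<in>V. d u y * x y)"
      using fin u0 u nonneg x by (intro member_le_sum) auto
    finally show ?thesis using eig u by simp
  qed
  obtain r where r: "r \<in> R" "r \<in> V" "r \<noteq> c" using R disj by blast
  \<comment> \<open>Since \<open>r\<close> and \<open>c\<close> differ, one of them is not
    \<open>u0\<close>.\<close>
  obtain u1 where "u1 \<in> V" "u1 \<noteq> u0" using r c by metis
  then have m: "m > 0" using pos[of u1] x(1)[of u1] by (simp add: zero_less_mult_iff)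
  have xpos: "x u > 0" if "u \<in> V" for u
    using pos[OF that] u0 m by (cases "u = u0") (auto simp: zero_less_mult_iff)
  define X where "X = (\<Sum>u\<in>S. x u)"
  define Y where "Y = (\<Sum>u\<in>R. x u)"
  have fS: "finite S" and fR: "finite R" using S R fin finite_subset by auto
  have restrict: "(\<Sum>y\<in>V. of_bool (y \<in> A) * x y) = sum x A" if "A \<subseteq> V" for A
  proof -
    have "(\<Sum>y\<in>V. of_bool (y \<in> A) * x y) = (\<Sum>y\<in>V. if y \<in> A then x y else 0)"
      by (intro sum.cong) auto
    then show ?thesis using sum.inter_restrict[OF fin, of x A] that by (simp add: Int_absorb1)
  qed
  have single: "(\<Sum>y\<in>V. of_bool (y = a) * x y) = x a" if "a \<in> V" for a
    using restrict[of "{a}"] that by simp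
  \<comment> \<open>In the eigenvalue equation at a vertex \<open>r\<close> of \<open>R\<close>, all
    of \<open>S\<close> and \<open>c\<close> have coefficient at least 1; the term for
    \<open>c\<close> makes the inequality strict.\<close>
  have mY: "m * Y > X"
  proof -
    have "X < X + x c" using xpos[OF c] by simp
    also have "\<dots> = (\<Sum>y\<in>insert c S. 1 * x y)" using disj fS by (simp add: X_def)
    also have "\<dots> \<le> (\<Sum>y\<in>insert c S. d r y * x y)"
      using dist[OF r(2)] S c r disj x by (intro sum_mono mult_right_mono) auto
    also have "\<dots> \<le> (\<Sum>y\<in>V. d r y * x y)"
      using fin S c nonneg r x by (intro sum_mono2) auto
    also have "\<dots> = m * x r" using eig r by simp
    also have "\<dots> \<le> m * Y"
      unfolding Y_def using m fR r x by (intro mult_left_mono member_le_sum) auto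
    finally show ?thesis .
  qed
  define \<kappa> where "\<kappa> = (m * Y - X) / (m + 1)"
  have "\<kappa> > 0" using mY m by (simp add: \<kappa>_def)
  \<comment> \<open>By \<open>twin\<close>, the equations at \<open>q u\<close> and \<open>c\<close>
    differ so that \<open>(m + 1) * (x (q u) - x c) = Y + X\<close>; hence the bracket has the same
    value for every \<open>u\<close>.\<close>
  have gap: "Y + x c - x (q u) = \<kappa>" if u: "u \<in> S" for u
  proof -
    have "m * x (q u) = (\<Sum>y\<in>V. d (q u) y * x y)" using eig q[OF u] by simp
    also have "\<dots> = (\<Sum>y\<in>V. d c y * x y + of_bool (y \<in> R) * x y + of_bool (y \<in> S) * x y
        + of_bool (y = c) * x y - of_bool (y = q u) * x y)"
      by (intro sum.cong refl, subst twin[OF u]) (assumption, simp only: ring_distribs)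
    also have "\<dots> = m * x c + Y + X + x c - x (q u)"
      using eig c q[OF u] S R
      by (simp only: sum.distrib sum_subtractf restrict single X_def Y_def)
    finally show ?thesis using m by (simp add: \<kappa>_def field_simps)
  qed
  have sumg: "(\<Sum>u\<in>V. \<Sum>y\<in>V. g u y * x u * x y) = X * \<kappa>"
  proof -
    have "(\<Sum>y\<in>V. g u y * x u * x y) = of_bool (u \<in> S) * x u * \<kappa>" if "u \<in> V" for u
    proof (cases "u \<in> S")
      case True
      have "(\<Sum>y\<in>V. g u y * x u * x y) = (\<Sum>y\<in>V. x u * (of_bool (y \<in> R) * x y
          + of_bool (y = c) * x y - of_bool (y = q u) * x y))"
        using True by (intro sum.cong refl) (simp add: g_def algebra_simps)
      also have "\<dots> = x u * (Y + x c - x (q u))"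
        using c q[OF True] R
        by (simp only: sum_distrib_left[symmetric] sum.distrib sum_subtractf restrict single Y_def)
      finally show ?thesis using gap True by simp
    qed (simp add: g_def)
    then have "(\<Sum>u\<in>V. \<Sum>y\<in>V. g u y * x u * x y) = (\<Sum>u\<in>V. of_bool (u \<in> S) * x u) * \<kappa>"
      by (simp add: sum_distrib_right)
    then show ?thesis using restrict[OF S(1)] by (simp add: X_def)
  qed
  have "X > 0" unfolding X_def using fS S xpos by (intro sum_pos) auto
  \<comment> \<open>The factor 2 accounts for \<open>g u y\<close> and \<open>g y u\<close>, whose
    sums agree after exchanging the order of summation.\<close>
  then have "quad_form V d x < quad_form V d x + 2 * (X * \<kappa>)" using \<open>\<kappa> > 0\<close> by simp
  also have "\<dots> = quad_form V d x + (\<Sum>u\<in>V. \<Sum>y\<in>V. g u y * x u * x y)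
      + (\<Sum>y\<in>V. \<Sum>u\<in>V. g u y * x u * x y)"
    using sumg sum.swap[of "\<lambda>u y. g u y * x u * x y" V V] by simp
  also have "\<dots> = (\<Sum>u\<in>V. \<Sum>y\<in>V. (d u y + g u y + g y u) * (x u * x y))"
    unfolding quad_form_def by (simp add: sum.distrib[symmetric] algebra_simps)
  also have "\<dots> \<le> quad_form V d' x"
    unfolding quad_form_def using increase x
    by (simp only: mult.assoc) (intro sum_mono mult_right_mono, auto)
  also have "\<dots> \<le> m' * (\<Sum>u\<in>V. (x u)\<^sup>2)" by (rule max')
  finally have "m * (\<Sum>u\<in>V. (x u)\<^sup>2) < m' * (\<Sum>u\<in>V. (x u)\<^sup>2)"
    using quad_form_eigenvector[OF eig] by simp
  moreover have "(\<Sum>u\<in>V. (x u)\<^sup>2) \<ge> 0" by (simp add: sum_nonneg)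
  ultimately show ?thesis by (metis mult_right_mono not_less)
qed

section \<open>Moving pendant branches\<close>

lemma hypergraph_distance_pos:
  assumes "hypergraph G" "hypergraph_connected G" "x \<in> verts G" "y \<in> verts G" "x \<noteq> y"
  shows "1 \<le> hypergraph_distance G x y"
  using hypergraph_distance_descent[OF assms(1-4)] assms(5) by auto

lemma hypergraph_distance_edge:
  assumes "hypergraph G" "hypergraph_connected G" "e \<in> edges G" "x \<in> e" "y \<in> e" "x \<noteq> y"
  shows "hypergraph_distance G x y = 1"
proof -
  have adj: "adjacent G x y" using assms unfolding adjacent_def by blast
  then have v: "x \<in> verts G" "y \<in> verts G" using adjacent_verts[OF assms(1) adj] by simp_all
  show ?thesis
    using hypergraph_distance_pos[OF assms(1,2) v assms(6)]
      hypergraph_distance_adjacent[OF assms(1,2) v(1) adj] hypergraph_distance_self[OF assms(1,2) v(1)]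
    by simp
qed

text \<open>A shortest path from outside \<open>e\<close> can enter \<open>e\<close> only through
  \<open>c\<close>, the only vertex of \<open>e\<close> that may lie on other edges; from there one
  step along \<open>e\<close> reaches \<open>u\<close>.\<close>

lemma hypergraph_distance_pendant_edge:
  assumes hyp: "hypergraph G" and conn: "hypergraph_connected G" and e: "e \<in> edges G" and c: "c \<in> e"
    and deg: "\<And>u. u \<in> e - {c} \<Longrightarrow> hypergraph_degree G u = 1"
    and y: "y \<in> verts G - e" and u: "u \<in> e - {c}"
  shows "hypergraph_distance G y u = hypergraph_distance G y c + 1"
proof -
  have yG: "y \<in> verts G" and eG: "e \<subseteq> verts G" using y hyp e by (auto simp: hypergraph_def)
  define f where "f = hypergraph_distance G y"
  have lip: "f b \<le> f a + 1" if "adjacent G a b" for a b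
    using hypergraph_distance_adjacent[OF hyp conn yG that] by (simp add: f_def)
  \<comment> \<open>The only edge through \<open>b\<close> is \<open>e\<close>, so the predecessor
    of \<open>b\<close> lies in \<open>e\<close> too. Hence no vertex of \<open>e\<close> other than
    \<open>c\<close> can minimize \<open>f\<close> on \<open>e\<close>.\<close>
  have pred: "\<exists>t\<in>e. f b = f t + 1" if b: "b \<in> e - {c}" for b
  proof -
    obtain t where t: "adjacent G t b" "f b = f t + 1"
      using hypergraph_distance_descent[OF hyp conn yG, of b] b eG y unfolding f_def by blast
    then obtain g where g: "g \<in> edges G" "t \<in> g" "b \<in> g" unfolding adjacent_def by blast
    obtain g' where g': "{g \<in> edges G. b \<in> g} = {g'}"
      using deg[OF b] by (auto simp: hypergraph_degree_def card_1_singleton_iff)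
    have "g \<in> {g \<in> edges G. b \<in> g}" "e \<in> {g \<in> edges G. b \<in> g}" using g e b by simp_all
    then have "g = e" unfolding g' by simp
    then show ?thesis using t(2) g(2) by blast
  qed
  obtain t where t: "t \<in> e" "\<And>b. b \<in> e \<Longrightarrow> f t \<le> f b"
    using ex_has_least_nat[of "\<lambda>b. b \<in> e" c f] c by blast
  have "t = c"
  proof (rule ccontr)
    assume "t \<noteq> c"
    then obtain b where "b \<in> e" "f t = f b + 1" using pred t(1) by blast
    then show False using t(2)[of b] by simp
  qed
  obtain b where "b \<in> e" "f u = f b + 1" using pred[OF u] by blast
  then have "f c + 1 \<le> f u" using t(2)[of b] \<open>t = c\<close> by simp
  moreover have "adjacent G c u" using e c u unfolding adjacent_def by blast
  then have "f u \<le> f c + 1" by (rule lip)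
  ultimately show ?thesis by (simp add: f_def)
qed

theorem theorem3p3:
  fixes G :: "'a hypergraph" and H :: "nat \<Rightarrow> 'a hypergraph"
    and e :: "'a set" and w v :: "nat \<Rightarrow> 'a" and k j :: nat
  assumes "k \<ge> 2"
    and "hypergraph G" and "hypergraph_uniform k G" and "hypergraph_connected G"
    and "card (edges G) \<ge> 2"
    and "e \<in> edges G" and "e = w ` {1..k}"
    and "\<forall>i\<in>{1..k - 1}. hypergraph_degree G (w i) = 1" and "hypergraph_degree G (w k) \<ge> 2"
    and "\<forall>i\<in>{1..k - 1}. hypergraph (H i) \<and> hypergraph_uniform k (H i) \<and> hypergraph_connected (H i) \<and> v i \<in> verts (H i)"
    and "\<forall>i\<in>{1..k - 1}. verts G \<inter> verts (H i) = {}"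
    and "disjoint_family_on (\<lambda>i. verts (H i)) {1..k - 1}"
    and "j \<in> {1..k - 1}" and "card (edges (H j)) \<ge> 1"
  shows "\<forall>s\<in>{j..k - 1}.
    distance_spectral_radius (attach_hypergraphs k G w 0 H v) > distance_spectral_radius (attach_hypergraphs k G w s H v)"
proof
  fix s assume s: "s \<in> {j..k - 1}"

  \<comment> \<open>The pendant edge and its vertices\<close>
  note hyp = \<open>hypergraph G\<close> and conn = \<open>hypergraph_connected G\<close> and eE = \<open>e \<in> edges G\<close>
    and e_eq = \<open>e = w ` {1..k}\<close>
  have eG: "e \<subseteq> verts G" using hyp eE by (auto simp: hypergraph_def)
  \<comment> \<open>Uniformity gives \<open>e\<close> exactly \<open>k\<close> vertices, so
    \<open>w\<close> lists them without repetition.\<close>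
  have "card (w ` {1..k}) = card {1..k}"
    using \<open>hypergraph_uniform k G\<close> eE e_eq by (simp add: hypergraph_uniform_def)
  then have inj: "inj_on w {1..k}" by (intro eq_card_imp_inj_on) auto
  have we: "w i \<in> e" if "i \<in> {1..k}" for i using that e_eq by blast
  have wG: "w i \<in> verts G" if "i \<in> {1..k}" for i using that we eG by blast
  define c where "c = w k"
  have ce: "c \<in> e" and cG: "c \<in> verts G" using we wG \<open>k \<ge> 2\<close> by (auto simp: c_def)
  have w_ne: "w i \<noteq> w l" if "i \<in> {1..k}" "l \<in> {1..k}" "i \<noteq> l" for i l
    using inj_onD[OF inj] that by blast
  have I_sub: "i \<in> {1..k} \<and> i \<noteq> k" if "i \<in> {1..k - 1}" for i
  proof -
    have "1 \<le> i" "i \<le> k - 1" using that by simp_all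
    moreover have "i \<le> k" "i \<noteq> k" using calculation \<open>k \<ge> 2\<close> by linarith+
    ultimately show ?thesis by simp
  qed
  have w_ne': "w i \<noteq> w l" if "i \<in> {1..k - 1}" "l \<in> {1..k - 1}" "i \<noteq> l" for i l
    by (rule w_ne) (use I_sub that in simp_all)
  have k_mem: "k \<in> {1..k}" using \<open>k \<ge> 2\<close> by simp
  have wc: "w i \<noteq> c" if "i \<in> {1..k - 1}" for i
    using w_ne[of i k] I_sub[OF that] k_mem by (simp add: c_def)
  have wI: "w i \<in> e" "w i \<in> verts G" if "i \<in> {1..k - 1}" for i
    using we wG I_sub[OF that] by simp_all
  have target: "attach_point k w t i \<in> verts G" if "i \<in> {1..k - 1}" for t i
    using wG I_sub[OF that] k_mem by (simp add: attach_point_def)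

  \<comment> \<open>The two glued hypergraphs and their distances\<close>
  have pieces: "hypergraph (H i)" "hypergraph_connected (H i)" "v i \<in> verts (H i)"
    "verts G \<inter> verts (H i) = {}" if "i \<in> {1..k - 1}" for i
    using bspec[OF assms(10) that] bspec[OF assms(11) that] by simp_all
  have gluing: "gluing G {1..k - 1} H v (attach_point k w t)" for t
    by (rule gluing.intro) (use hyp conn pieces assms(12) target in simp_all)
  interpret A: gluing G "{1..k - 1}" H v "attach_point k w 0" by (rule gluing)
  interpret B: gluing G "{1..k - 1}" H v "attach_point k w s" by (rule gluing)
  have glueA: "attach_hypergraphs k G w 0 H v = A.glue"
    by (simp only: attach_hypergraphs_def A.glue_def)
  have glueB: "attach_hypergraphs k G w s H v = B.glue"
    by (simp only: attach_hypergraphs_def B.glue_def)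
  define V where "V = verts G \<union> (\<Union>i\<in>{1..k - 1}. A.branch i)"
  have VA: "verts A.glue = V" and VB: "verts B.glue = V"
    unfolding V_def by (rule A.verts_glue, rule B.verts_glue)
  have finV: "finite V" and neV: "V \<noteq> {}"
    using A.hypergraph_glue VA by (auto simp: hypergraph_def)
  define dA where "dA u y = real (hypergraph_distance A.glue u y)" for u y
  define dB where "dB u y = real (hypergraph_distance B.glue u y)" for u y
  have symA: "dA u y = dA y u" and symB: "dB u y = dB y u" for u y
    by (simp_all add: dA_def dB_def hypergraph_distance_sym)
  define dG where "dG u y = real (hypergraph_distance G u y)" for u y
  define h where "h i u = real (hypergraph_distance (H i) (v i) u)" for i u
  have baseA: "dA u y = dG u y" and baseB: "dB u y = dG u y" if "u \<in> verts G" "y \<in> verts G" for u y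
    using A.hypergraph_distance_glue_base B.hypergraph_distance_glue_base that
    by (simp_all add: dA_def dB_def dG_def)
  \<comment> \<open>Piece indices start at 1, so for the value 0 the attachment vertex of piece
    \<open>i\<close> is \<open>w i\<close>.\<close>
  have mixA: "dA u y = h i u + dG (w i) y" if "i \<in> {1..k - 1}" "u \<in> A.branch i" "y \<in> verts G" for i u y
    using A.hypergraph_distance_glue_branch_base[OF that] that(1)
    by (simp add: dA_def dG_def h_def attach_point_def)
  have mixB: "dB u y = h i u + dG (attach_point k w s i) y"
    if "i \<in> {1..k - 1}" "u \<in> A.branch i" "y \<in> verts G" for i u y
    using B.hypergraph_distance_glue_branch_base[OF that] by (simp add: dB_def dG_def h_def)
  have same: "dA u y = dB u y" if "i \<in> {1..k - 1}" "u \<in> A.branch i" "y \<in> A.branch i" for i u y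
    using A.hypergraph_distance_glue_same_branch[OF that] B.hypergraph_distance_glue_same_branch[OF that]
    by (simp add: dA_def dB_def)
  have diffA: "dA u y = h i u + dG (w i) (w l) + h l y"
    if "i \<in> {1..k - 1}" "l \<in> {1..k - 1}" "i \<noteq> l" "u \<in> A.branch i" "y \<in> A.branch l" for i l u y
    using A.hypergraph_distance_glue_branches[OF that] that(1,2)
    by (simp add: dA_def dG_def h_def attach_point_def)
  have diffB: "dB u y = h i u + dG (attach_point k w s i) (attach_point k w s l) + h l y"
    if "i \<in> {1..k - 1}" "l \<in> {1..k - 1}" "i \<noteq> l" "u \<in> A.branch i" "y \<in> A.branch l" for i l u y
    using B.hypergraph_distance_glue_branches[OF that] by (simp add: dB_def dG_def h_def)
  have att: "attach_point k w s i = (if i \<le> s then c else w i)" for i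
    by (simp add: attach_point_def c_def)

  \<comment> \<open>Moved vertices, and distances around the pendant edge\<close>
  define S where "S = (\<Union>i\<in>{1..s}. A.branch i)"
  define R where "R = verts G - e"
  define q where "q u = w (A.index u)" for u
  have S_iff: "u \<in> S \<longleftrightarrow> i \<le> s" if "i \<in> {1..k - 1}" "u \<in> A.branch i" for i u
  proof
    assume "u \<in> S"
    then obtain l where "l \<in> {1..s}" "u \<in> A.branch l" by (auto simp: S_def)
    moreover from this have "l = i" using A.branch_unique[of l i u] that s by auto
    ultimately show "i \<le> s" by simp
  qed (use that in \<open>auto simp: S_def\<close>)
  have S_obtain: "\<exists>i. i \<in> {1..k - 1} \<and> i \<le> s \<and> u \<in> A.branch i \<and> q u = w i" if u: "u \<in> S" for u
  proof -
    obtain i where i: "i \<in> {1..s}" "u \<in> A.branch i" using u unfolding S_def by blast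
    then have "i \<in> {1..k - 1}" using s by simp
    then show ?thesis using A.index[of i u] i by (auto simp: q_def)
  qed
  have S_base: "u \<notin> verts G" if "u \<in> S" for u using S_obtain[OF that] A.branch_base by blast
  have dG_self: "dG u u = 0" if "u \<in> verts G" for u
    using hypergraph_distance_self[OF hyp conn that] by (simp add: dG_def)
  have dG_edge: "dG u y = 1" if "u \<in> e" "y \<in> e" "u \<noteq> y" for u y
    using hypergraph_distance_edge[OF hyp conn eE that] by (simp add: dG_def)
  \<comment> \<open>Off \<open>e\<close>, the vertex \<open>w i\<close> is one step farther than
    \<open>c\<close>. Distinct vertices of \<open>e\<close> are at distance 1, so on
    \<open>e\<close> the two distances differ only at \<open>c\<close> and at \<open>w i\<close>,
    where one of them is 0.\<close>
  have twin_base: "dG (w i) y = dG c y + of_bool (y \<in> R) + of_bool (y = c) - of_bool (y = w i)"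
    if i: "i \<in> {1..k - 1}" and y: "y \<in> verts G" for i y
  proof (cases "y \<in> e")
    case True
    have "w i \<in> e" using wI i by blast
    then show ?thesis
      using True y dG_self dG_edge[of "w i" y] dG_edge[of c y] ce wc[OF i] by (auto simp: R_def)
  next
    case False
    have "hypergraph_degree G u = 1" if u: "u \<in> e - {c}" for u
    proof -
      obtain l where l: "l \<in> {1..k}" "u = w l" using u e_eq by blast
      then have "l \<noteq> k" using u by (auto simp: c_def)
      moreover have "1 \<le> l" "l \<le> k" using l(1) by simp_all
      ultimately have "l \<le> k - 1" by linarith
      with \<open>1 \<le> l\<close> have "l \<in> {1..k - 1}" by simp
      then show ?thesis using assms(8) l(2) by blast
    qed
    moreover have "w i \<in> e - {c}" using wI(1)[OF i] wc[OF i] by simp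
    ultimately have "hypergraph_distance G y (w i) = hypergraph_distance G y c + 1"
      using hypergraph_distance_pendant_edge[OF hyp conn eE ce] y False by blast
    then show ?thesis
      using y False ce \<open>w i \<in> e - {c}\<close>
      by (auto simp: dG_def R_def hypergraph_distance_sym[of G _ y])
  qed
  have V_cases: "y \<in> verts G \<or> (\<exists>l\<in>{1..k - 1}. y \<in> A.branch l)" if "y \<in> V" for y
    using that by (auto simp: V_def)

  \<comment> \<open>Comparison of the two distance matrices\<close>
  have twin: "dB (q u) y = dB c y + of_bool (y \<in> R) + of_bool (y \<in> S) + of_bool (y = c) - of_bool (y = q u)"
    if u: "u \<in> S" and y: "y \<in> V" for u y
  proof -
    obtain i where i: "i \<in> {1..k - 1}" "i \<le> s" "q u = w i" using S_obtain[OF u] by blast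
    have wi: "w i \<in> e" "w i \<in> verts G" using wI[OF i(1)] by simp_all
    show ?thesis
    proof (cases "y \<in> verts G")
      case True
      then show ?thesis
        using twin_base[OF i(1) True] baseB[OF wi(2) True] baseB[OF cG True] S_base[of y] i(3)
        by auto
    next
      case False
      then obtain l where l: "l \<in> {1..k - 1}" "y \<in> A.branch l" using V_cases y by blast
      have wl: "w l \<in> e" "w l \<noteq> c" using wI(1)[OF l(1)] wc[OF l(1)] by simp_all
      \<comment> \<open>For \<open>l \<le> s\<close> piece \<open>l\<close> hangs at
        \<open>c\<close>, at distance 1 from \<open>w i\<close>. For \<open>l > s\<close> it hangs
        at \<open>w l\<close>, which differs from \<open>w i\<close> because
        \<open>i \<le> s\<close> and is at distance 1 from both. This yields the term for
        \<open>S\<close>.\<close>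
      have "dG (attach_point k w s l) (w i) = dG (attach_point k w s l) c + of_bool (l \<le> s)"
      proof (cases "l \<le> s")
        case True
        then show ?thesis
          using dG_self[OF cG] dG_edge[OF ce wi(1)] wc[OF i(1)] by (simp add: att)
      next
        case False
        then have "w l \<noteq> w i" using w_ne'[OF l(1) i(1)] i(2) by blast
        then show ?thesis
          using False dG_edge[OF wl(1) wi(1)] dG_edge[OF wl(1) ce wl(2)] by (simp add: att)
      qed
      moreover have "y \<notin> R" "y \<noteq> c" "y \<noteq> w i" using False cG wi by (auto simp: R_def)
      ultimately show ?thesis
        using mixB[OF l wi(2)] mixB[OF l cG] S_iff[OF l] i(3) symB[of y] by simp
    qed
  qed
  \<comment> \<open>The piece of \<open>u\<close> moves from \<open>c\<close> to \<open>w i\<close>,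
    so towards \<open>G\<close> the change is exactly that of \<open>twin_base\<close>. Within the
    piece nothing changes.\<close>
  have moved: "dA u y \<ge> dB u y + of_bool (y \<in> R) + of_bool (y = c) - of_bool (y = q u)"
    if u: "u \<in> S" and y: "y \<in> V" for u y
  proof -
    obtain i where i: "i \<in> {1..k - 1}" "i \<le> s" "u \<in> A.branch i" "q u = w i"
      using S_obtain[OF u] by blast
    have wi: "w i \<in> e" "w i \<in> verts G" using wI[OF i(1)] by simp_all
    show ?thesis
    proof (cases "y \<in> verts G")
      case True
      then show ?thesis
        using twin_base[OF i(1) True] mixA[OF i(1,3) True] mixB[OF i(1,3) True] i by (simp add: att)
    next
      case False
      then obtain l where l: "l \<in> {1..k - 1}" "y \<in> A.branch l" using V_cases y by blast
      have "dA u y \<ge> dB u y"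
      proof (cases "l = i")
        case True
        then show ?thesis using same[of i u y] i l by simp
      next
        case False
        have wl: "w l \<in> e" "w l \<noteq> c" using wI(1)[OF l(1)] wc[OF l(1)] by simp_all
        \<comment> \<open>The left side is 1; the right side is 0 or 1, according to whether piece
          \<open>l\<close> also hangs at \<open>c\<close>.\<close>
        have "dG (w i) (w l) \<ge> dG c (attach_point k w s l)"
          using False dG_self[OF cG] dG_edge[OF wi(1) wl(1)] dG_edge[OF ce wl(1)] wl(2)
            w_ne'[OF i(1) l(1)] by (simp add: att)
        then show ?thesis
          using diffA[OF i(1) l(1) _ i(3) l(2)] diffB[OF i(1) l(1) _ i(3) l(2)] False i
          by (simp add: att)
      qed
      moreover have "y \<notin> R" "y \<noteq> c" using False cG by (auto simp: R_def)
      ultimately show ?thesis by (cases "y = q u") simp_all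
    qed
  qed
  \<comment> \<open>A branch vertex outside \<open>S\<close> belongs to a piece with index above
    \<open>s\<close>, which has the same attachment vertex in both hypergraphs.\<close>
  have unmoved: "dA u y = dB u y" if u: "u \<in> V" "u \<notin> S" and y: "y \<in> V" "y \<notin> S" for u y
  proof -
    have mix: "dA u y = dB u y" if "i \<in> {1..k - 1}" "u \<in> A.branch i" "u \<notin> S" "y \<in> verts G" for i u y
      using mixA[OF that(1,2,4)] mixB[OF that(1,2,4)] S_iff[OF that(1,2)] that(3) by (simp add: att)
    consider "u \<in> verts G" "y \<in> verts G"
      | i where "i \<in> {1..k - 1}" "u \<in> A.branch i" "y \<in> verts G"
      | l where "l \<in> {1..k - 1}" "y \<in> A.branch l" "u \<in> verts G"
      | i l where "i \<in> {1..k - 1}" "u \<in> A.branch i" "l \<in> {1..k - 1}" "y \<in> A.branch l"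
      using V_cases[OF u(1)] V_cases[OF y(1)] by blast
    then show ?thesis
    proof cases
      case 1
      then show ?thesis by (simp add: baseA baseB)
    next
      case 2
      then show ?thesis using mix[of i u y] u(2) by simp
    next
      case 3
      then show ?thesis using mix[of l y u] y(2) symA[of u y] symB[of u y] by simp
    next
      case 4
      then show ?thesis
        using same[of i u y] diffA[of i l u y] diffB[of i l u y] S_iff[of i u] S_iff[of l y] u(2) y(2)
        by (cases "i = l") (simp_all add: att)
    qed
  qed

  \<comment> \<open>Moved vertices and vertices off the pendant edge exist\<close>
  have SV: "S \<subseteq> V" using s by (auto simp: S_def V_def)
  have S_ne: "S \<noteq> {}"
  proof -
    obtain f where f: "f \<in> edges (H j)" using \<open>card (edges (H j)) \<ge> 1\<close> by fastforce
    have "card f = k" "f \<subseteq> verts (H j)"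
      using f assms(10) \<open>j \<in> {1..k - 1}\<close> by (auto simp: hypergraph_uniform_def hypergraph_def)
    \<comment> \<open>An edge of \<open>H j\<close> has \<open>k \<ge> 2\<close> vertices, hence one
      besides the root, and \<open>j \<le> s\<close> puts it into \<open>S\<close>.\<close>
    then have "\<not> f \<subseteq> {v j}" using card_mono[of "{v j}" f] \<open>k \<ge> 2\<close> by auto
    then have "A.branch j \<noteq> {}" using \<open>f \<subseteq> verts (H j)\<close> by (auto simp: A.branch_def)
    then show ?thesis using s \<open>j \<in> {1..k - 1}\<close> by (auto simp: S_def)
  qed
  have R_ne: "R \<noteq> {}"
  proof -
    have "\<not> {f \<in> edges G. c \<in> f} \<subseteq> {e}"
      using card_mono[of "{e}" "{f \<in> edges G. c \<in> f}"] \<open>hypergraph_degree G (w k) \<ge> 2\<close>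
      by (auto simp: hypergraph_degree_def c_def)
    then obtain f where f: "f \<in> edges G" "f \<noteq> e" by blast
    \<comment> \<open>A second edge at \<open>c\<close> has as many vertices as \<open>e\<close>, so
      it cannot be contained in \<open>e\<close>.\<close>
    have "finite e" "card f = card e"
      using f eE e_eq \<open>hypergraph_uniform k G\<close> by (auto simp: hypergraph_uniform_def)
    then have "\<not> f \<subseteq> e" using card_subset_eq f(2) by blast
    then show ?thesis using f(1) hyp by (auto simp: R_def hypergraph_def)
  qed

  \<comment> \<open>Comparison of the spectral radii\<close>
  obtain x where x: "\<And>u. 0 \<le> x u" "\<exists>u\<in>V. x u \<noteq> 0"
    "\<forall>u\<in>V. (\<Sum>y\<in>V. dB u y * x y) = distance_spectral_radius B.glue * x u"
    using distance_spectral_radius_nonneg_eigenvector[of B.glue, unfolded VB, OF finV neV, folded dB_def]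
    by blast
  have maxA: "quad_form V dA z \<le> distance_spectral_radius A.glue * (\<Sum>u\<in>V. (z u)\<^sup>2)" for z
    by (rule quad_form_le_distance_spectral_radius[of A.glue, unfolded VA, OF finV neV, folded dA_def])
  have increase: "dA u y \<ge> dB u y
      + of_bool (u \<in> S) * (of_bool (y \<in> R) + of_bool (y = c) - of_bool (y = q u))
      + of_bool (y \<in> S) * (of_bool (u \<in> R) + of_bool (u = c) - of_bool (u = q y))"
    if u: "u \<in> V" and y: "y \<in> V" for u y
  proof -
    have q_base: "q b \<in> verts G" if "b \<in> S" for b using S_obtain[OF that] wI(2) by metis
    \<comment> \<open>For two vertices of \<open>S\<close> both correction terms vanish, since
      \<open>R\<close>, \<open>c\<close> and the values of \<open>q\<close> lie in \<open>G\<close>.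
      If only one is in \<open>S\<close>, a single term survives and \<open>moved\<close> applies,
      up to symmetry.\<close>
    then have inner: "a \<notin> R \<and> a \<noteq> c \<and> (\<forall>b\<in>S. a \<noteq> q b)" if "a \<in> S" for a
      using S_base[OF that] cG unfolding R_def by auto
    show ?thesis
      using moved[of u y] moved[of y u] unmoved[of u y] inner[of u] inner[of y] u y
        symA[of u y] symB[of u y]
      by (cases "u \<in> S"; cases "y \<in> S") auto
  qed
  have "distance_spectral_radius B.glue < distance_spectral_radius A.glue"
  proof (rule quad_form_eigenvalue_less[OF finV _ _ x maxA SV S_ne _ R_ne _ _ _ _ _ twin increase])
    show "1 \<le> dB u y" if "u \<in> V" "y \<in> V" "u \<noteq> y" for u y
      using B.hypergraph_distance_glue_pos[of u y] that VB by (simp add: dB_def)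
    show "0 \<le> dB u y" for u y by (simp add: dB_def)
    show "R \<subseteq> V" "c \<in> V" using cG by (auto simp: R_def V_def)
    show "S \<inter> R = {}" "c \<notin> S" "c \<notin> R" using S_base cG ce by (auto simp: R_def)
    show "q u \<in> V" if "u \<in> S" for u using S_obtain[OF that] wI(2) unfolding V_def by (metis UnI1)
  qed
  then show "distance_spectral_radius (attach_hypergraphs k G w s H v)
      < distance_spectral_radius (attach_hypergraphs k G w 0 H v)"
    by (simp add: glueA glueB)
qed

end
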